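(* Let $g$, $q_d$, $\alpha$, $\beta$ be as defined in the context (associated with a real polynomial $p$, an interval $[a,b]$ and a degree $d$). Define $\Delta_\theta=\min\{|\theta-\alpha|,|\theta-\beta|\}$ and $\|f\|_{L_\infty(\phi_1,\phi_2)}=\sup_{\phi\in(\phi_1,\phi_2)}|f(\phi)|$. Then for every $\theta\in(\beta,\alpha)$ and every $d\ge2$, $$|q_d(\theta)-g(\theta)|\le\frac{\pi^6\,\|g\|_{L_\infty(0,\pi)}}{\Delta_\theta^4\,(d+2)^3}+\frac{\pi^4\,\|g''\|_{L_\infty(\beta,\alpha)}}{8(d+2)^2}.$$
   Context: Let $-1\le a<b\le 1$, let $M\ge 1$ be an integer, let $p\in\mathcal P_{M-1}$ (real polynomials of degree at most $M-1$), and let $d$ be a positive integer. Let $h(t)=1$ for $t\in(a,b)$, $h(t)=\frac12$ for $t\in\{a,b\}$, $h(t)=0$ for $t\in[-1,1]\setminus[a,b]$, and $\tilde h(t)=p(t)h(t)$. $T_j$ is the Chebyshev polynomial of the first kind of degree $j$. The Chebyshev--Jackson expansion of degree $d$ is $$F_d(p)(t)=\frac{c_0}{2}+\sum_{j=1}^d\rho_{j,d}\,c_j\,T_j(t),\qquad c_j=\frac2\pi\int_a^b\frac{p(t)T_j(t)}{\sqrt{1-t^2}}\,dt,$$ with Jackson damping factors $$\rho_{j,d}=\frac{\sin((j+1)\alpha_d)}{(d+2)\sin(\alpha_d)}+\Bigl(1-\frac{j+1}{d+2}\Bigr)\cos(j\alpha_d),\qquad \alpha_d=\frac{\pi}{d+2}.$$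 Put $\alpha=\arccos(a)$, $\beta=\arccos(b)$, so $0\le\beta<\alpha\le\pi$. The $2\pi$-periodic function $g$ is $g(\theta)=\tilde h(\cos\theta)$, i.e. on $[-\pi,\pi]$: $g(\theta)=p(\cos\theta)$ for $\theta\in(-\alpha,-\beta)\cup(\beta,\alpha)$, $g(\theta)=\frac12p(\cos\theta)$ for $\theta\in\{\pm\alpha,\pm\beta\}$, and $g(\theta)=0$ otherwise. (On $(\beta,\alpha)$, $g(\theta)=p(\cos\theta)$ is smooth, and $g''$ is its second derivative there.) Finally $$q_d(\theta)=F_d(p)(\cos\theta)=\frac{c_0}{2}+\sum_{j=1}^d\rho_{j,d}c_j\cos(j\theta).$$ *)

theory Defs
  imports "HOL-Analysis.Analysis" "HOL-Computational_Algebra.Polynomial"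
begin

fun cheb_T :: "nat \<Rightarrow> real poly" where
  "cheb_T 0 = 1"
| "cheb_T (Suc 0) = [:0, 1:]"
| "cheb_T (Suc (Suc n)) = 2 * [:0, 1:] * cheb_T (Suc n) - cheb_T n"

definition window :: "real \<Rightarrow> real \<Rightarrow> real \<Rightarrow> real" where
  "window a b t =
     (if a < t \<and> t < b then 1 else if t = a \<or> t = b then 1 / 2 else 0)"

definition windowed_poly :: "real poly \<Rightarrow> real \<Rightarrow> real \<Rightarrow> real \<Rightarrow> real" where
  "windowed_poly p a b t = poly p t * window a b t"

text \<open>The integrand is possibly unbounded at \<open>-1\<close> and \<open>1\<close>, but absolutely integrable; its value
  at these points (division by zero) is irrelevant.\<close>

definition cheb_coeff :: "real poly \<Rightarrow> real \<Rightarrow> real \<Rightarrow> nat \<Rightarrow> real" where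
  "cheb_coeff p a b j =
     2 / pi * integral {a..b} (\<lambda>t. poly p t * poly (cheb_T j) t / sqrt (1 - t\<^sup>2))"

definition jackson_angle :: "nat \<Rightarrow> real" where
  "jackson_angle d = pi / (real d + 2)"

definition jackson_damping :: "nat \<Rightarrow> nat \<Rightarrow> real" where
  "jackson_damping j d =
     sin ((real j + 1) * jackson_angle d) / ((real d + 2) * sin (jackson_angle d))
     + (1 - (real j + 1) / (real d + 2)) * cos (real j * jackson_angle d)"

definition cheb_jackson :: "nat \<Rightarrow> real poly \<Rightarrow> real \<Rightarrow> real \<Rightarrow> real \<Rightarrow> real" where
  "cheb_jackson d p a b t =
     cheb_coeff p a b 0 / 2
     + (\<Sum>j = 1..d. jackson_damping j d * cheb_coeff p a b j * poly (cheb_T j) t)"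

definition g_fun :: "real poly \<Rightarrow> real \<Rightarrow> real \<Rightarrow> real \<Rightarrow> real" where
  "g_fun p a b \<theta> = windowed_poly p a b (cos \<theta>)"

definition q_fun :: "nat \<Rightarrow> real poly \<Rightarrow> real \<Rightarrow> real \<Rightarrow> real \<Rightarrow> real" where
  "q_fun d p a b \<theta> = cheb_jackson d p a b (cos \<theta>)"

text \<open>A pointwise, not an essential, supremum.  It is meaningful only for functions bounded on a
  nonempty interval.\<close>

definition sup_norm_on :: "real \<Rightarrow> real \<Rightarrow> (real \<Rightarrow> real) \<Rightarrow> real" where
  "sup_norm_on l r f = (SUP \<phi>\<in>{l<..<r}. \<bar>f \<phi>\<bar>)"

end

theory Submission
  imports Defs
begin

text \<open>The value \<open>q\<^sub>d(\<theta>)\<close> is the average of \<open>g\<close> against the Jackson kernel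
  \<open>K = 1/2 + \<Sum> \<rho>\<^sub>j cos(j \<cdot>)\<close>.  The damping factors are the autocorrelation of the sequence
  \<open>sin((k+1)\<alpha>\<^sub>d)\<close>, so \<open>K\<close> is the squared modulus of a trigonometric sum and hence
  nonnegative, and the integrals of \<open>(1 - cos) K\<close> and \<open>(1 - cos)\<^sup>2 K\<close> depend only on
  \<open>\<rho>\<^sub>1\<close> and \<open>\<rho>\<^sub>2\<close>.  They are of order \<open>(d+2)\<^sup>-\<^sup>2\<close> and \<open>(d+2)\<^sup>-\<^sup>3\<close>.
  Within distance \<open>\<Delta>\<^sub>\<theta>\<close> of \<open>\<theta>\<close>, Taylor's formula applies; the linear term integrates to zero
  because \<open>K\<close> is even, and the quadratic one is dominated by \<open>1 - cos\<close>.  Farther away,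
  \<open>(1 - cos)\<^sup>2\<close> is at least \<open>4 \<Delta>\<^sub>\<theta>\<^sup>4 / \<pi>\<^sup>4\<close>, so it dominates the bounded difference
  \<open>g(\<phi>) - g(\<theta>)\<close>.\<close>

section \<open>Chebyshev polynomials and trigonometric sums\<close>

lemma poly_cheb_T_cos: "poly (cheb_T n) (cos x) = cos (real n * x)"
proof (induction n rule: cheb_T.induct)
  case (3 n)
  have "cos (real (Suc (Suc n)) * x) + cos (real n * x) = 2 * cos x * cos (real (Suc n) * x)"
    by (simp add: cos_plus_cos algebra_simps add_divide_distrib)
  with 3 show ?case by (simp add: algebra_simps)
qed auto

text \<open>Product-to-sum makes the terms telescope. Keeping the factor \<open>sin x\<close> on the
  left avoids any condition on its zeros.\<close>

lemma sum_cos_arith_prog: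
  fixes c x :: real
  shows "sin x * (\<Sum>k<n. cos (c + 2 * real k * x)) = sin (real n * x) * cos (c + (real n - 1) * x)"
proof (induction n)
  case (Suc n)
  have *: "sin y * cos z = (sin (z + y) - sin (z - y)) / 2" for y z :: real
    by (simp add: sin_add sin_diff)
  have "sin (real n * x) * cos (c + (real n - 1) * x) + sin x * cos (c + 2 * real n * x)
      = sin ((real n + 1) * x) * cos (c + real n * x)"
    unfolding * by (simp add: algebra_simps diff_divide_distrib)
  moreover have "sin x * (\<Sum>k<Suc n. cos (c + 2 * real k * x))
     = sin (real n * x) * cos (c + (real n - 1) * x) + sin x * cos (c + 2 * real n * x)"
    using Suc by (simp add: distrib_left)
  ultimately show ?case by (simp add: add.commute)
qed simp

text \<open>By symmetry the two diagonals at distance \<open>j\<close> agree. Going from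
  \<open>d\<close> to \<open>Suc d\<close> adds a row and a column, which extend each pair of
  off-diagonals by one entry, open the pair at \<open>j = Suc d\<close>, and share one new diagonal
  entry.\<close>

lemma sum_symmetric_by_diagonals:
  fixes f :: "nat \<Rightarrow> nat \<Rightarrow> 'a::comm_ring_1"
  assumes sym: "\<And>k l. f k l = f l k"
  shows "(\<Sum>k\<le>d. \<Sum>l\<le>d. f k l) = (\<Sum>k\<le>d. f k k) + 2 * (\<Sum>j=1..d. \<Sum>k\<le>d-j. f k (k+j))"
proof (induction d)
  case (Suc d)
  have "(\<Sum>k\<le>d. f k (Suc d)) = (\<Sum>j=1..Suc d. f (Suc d - j) (Suc d))"
    by (rule sum.reindex_bij_witness[of _ "\<lambda>j. Suc d - j" "\<lambda>k. Suc d - k"]) auto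
  moreover have "(\<Sum>k\<le>Suc d - j. f k (k + j)) = (\<Sum>k\<le>d-j. f k (k+j)) + f (Suc d - j) (Suc d)"
    if "j \<in> {1..d}" for j
    using that by (simp add: Suc_diff_le)
  moreover have "(\<Sum>k\<le>d. f (Suc d) k) = (\<Sum>k\<le>d. f k (Suc d))"
    by (simp add: sym)
  ultimately show ?case
    using Suc by (simp add: sum.distrib algebra_simps)
qed simp

section \<open>The Jackson kernel: damping factors and nonnegativity\<close>

text \<open>The constant term 1/2 gives the kernel integral pi over a period, so averages against it
  carry the factor 1/pi of the Chebyshev coefficients.\<close>

definition jackson_kernel :: "nat \<Rightarrow> real \<Rightarrow> real" where
  "jackson_kernel d x = 1 / 2 + (\<Sum>j = 1..d. jackson_damping j d * cos (real j * x))"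

lemma jackson_angle_bounds: "0 < jackson_angle d" "jackson_angle d < pi"
  by (auto simp: jackson_angle_def divide_less_eq distrib_left intro!: add_pos_nonneg)

lemma sin_jackson_angle_pos: "0 < sin (jackson_angle d)"
  using jackson_angle_bounds by (intro sin_gt_zero)

lemma jackson_damping_0 [simp]: "jackson_damping 0 d = 1"
proof -
  have "sin (jackson_angle d) / ((real d + 2) * sin (jackson_angle d)) = 1 / (real d + 2)"
    using sin_jackson_angle_pos[of d] by simp
  then show ?thesis by (simp add: jackson_damping_def)
qed

lemma jackson_damping_1: "jackson_damping 1 d = cos (jackson_angle d)"
proof -
  have "sin (2 * jackson_angle d) / ((real d + 2) * sin (jackson_angle d))
      = 2 * cos (jackson_angle d) / (real d + 2)"
    unfolding sin_double using sin_jackson_angle_pos[of d] by simp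
  then show ?thesis
    by (simp add: jackson_damping_def field_simps)
qed

lemma jackson_damping_2:
  "jackson_damping 2 d
   = cos (2 * jackson_angle d) + 2 * (sin (jackson_angle d))\<^sup>2 / (real d + 2)"
proof -
  have "sin (3 * x) = sin x * (3 - 4 * (sin x)\<^sup>2)" for x :: real
  proof -
    have "sin (3 * x) = 2 * sin x * (cos x)\<^sup>2 + (1 - 2 * (sin x)\<^sup>2) * sin x"
      using sin_add[of "2 * x" x] by (simp add: sin_double cos_double_sin power2_eq_square)
    then show ?thesis by (simp add: cos_squared_eq algebra_simps)
  qed
  then have "sin (3 * jackson_angle d) / ((real d + 2) * sin (jackson_angle d))
      = (3 - 4 * (sin (jackson_angle d))\<^sup>2) / (real d + 2)"
    using sin_jackson_angle_pos[of d] by simp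
  \<comment> \<open>Here \<open>y\<close> stands for the squared sine of the angle and
    \<open>N\<close> for \<open>d + 2\<close>.\<close>
  moreover have "(3 - 4 * y) / N + (1 - 3 / N) * (1 - 2 * y) = (1 - 2 * y) + 2 * y / N"
    if "N > 0" for y N :: real
    using that by (simp add: field_simps)
  ultimately show ?thesis
    by (simp add: jackson_damping_def cos_double_sin)
qed

text \<open>Each product is half the difference of the fixed value \<open>cos (j x)\<close> and a
  cosine whose argument runs through an arithmetic progression. The latter sum has a closed form,
  and the choice of angle simplifies it.\<close>

lemma jackson_damping_autocorrelation:
  assumes "j \<le> d"
  shows "(\<Sum>k\<le>d-j. sin ((real k + 1) * jackson_angle d) * sin ((real (k + j) + 1) * jackson_angle d))
         = (real d + 2) / 2 * jackson_damping j d"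
proof -
  define x where "x = jackson_angle d"
  define n where "n = Suc (d - j)"
  have n: "real n = real d + 1 - real j" using assms by (simp add: n_def of_nat_diff)
  have Nx: "(real d + 2) * x = pi" by (simp add: x_def jackson_angle_def field_simps)
  have s: "sin x \<noteq> 0" using sin_jackson_angle_pos[of d] by (simp add: x_def)
  have "sin x * (\<Sum>k<n. cos ((real j + 2) * x + 2 * real k * x))
      = sin (real n * x) * cos ((real j + 2) * x + (real n - 1) * x)"
    by (rule sum_cos_arith_prog)
  \<comment> \<open>Since \<open>(d + 2) * x = pi\<close>, the cosine equals -1 and the sine of
    \<open>n x\<close> becomes that of \<open>(j + 1) x\<close>.\<close>
  also have "(real j + 2) * x + (real n - 1) * x = pi"
    unfolding n Nx[symmetric] by (simp add: algebra_simps)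
  also have "real n * x = pi - (real j + 1) * x"
    unfolding n Nx[symmetric] by (simp add: algebra_simps)
  finally have c: "(\<Sum>k<n. cos ((real j + 2) * x + 2 * real k * x)) = - sin ((real j + 1) * x) / sin x"
    using s by (simp add: field_simps)
  have *: "sin ((real k + 1) * x) * sin ((real (k + j) + 1) * x)
      = (cos (real j * x) - cos ((real j + 2) * x + 2 * real k * x)) / 2" for k
  proof -
    have "(real k + 1) * x - (real (k + j) + 1) * x = - (real j * x)"
      "(real k + 1) * x + (real (k + j) + 1) * x = (real j + 2) * x + 2 * real k * x"
      by (simp_all add: algebra_simps)
    then show ?thesis by (simp only: sin_times_sin cos_minus)
  qed
  have "(\<Sum>k\<le>d-j. sin ((real k + 1) * x) * sin ((real (k + j) + 1) * x))
      = (\<Sum>k<n. (cos (real j * x) - cos ((real j + 2) * x + 2 * real k * x)) / 2)"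
    unfolding * n_def lessThan_Suc_atMost ..
  also have "\<dots> = (real n * cos (real j * x) + sin ((real j + 1) * x) / sin x) / 2"
    by (simp only: sum_divide_distrib[symmetric] sum_subtractf c) simp
  also have "\<dots> = (real d + 2) / 2 * jackson_damping j d"
  proof -
    have aux: "((N - (real j + 1)) * C + A / sin x) / 2
        = N / 2 * (A / (N * sin x) + (1 - (real j + 1) / N) * C)"
      if "N > 0" for N A C :: real
      using that s by (simp add: field_simps)
    have "real n = (real d + 2) - (real j + 1)" by (simp add: n)
    then show ?thesis
      unfolding jackson_damping_def x_def[symmetric] by (simp only:) (rule aux, simp)
  qed
  finally show ?thesis by (simp add: x_def)
qed

text \<open>The squares of the real and imaginary parts of the sum of u_k exp(i k x) add up to
  \<open>d + 2\<close> times the kernel: the entries at distance \<open>j\<close> in the double sum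
  contribute the autocorrelation at lag \<open>j\<close> times \<open>cos (j x)\<close>.\<close>

lemma jackson_kernel_nonneg: "0 \<le> jackson_kernel d x"
proof -
  define u where "u k = sin ((real k + 1) * jackson_angle d)" for k :: nat
  have "(\<Sum>k\<le>d. u k * cos (real k * x))\<^sup>2 + (\<Sum>k\<le>d. u k * sin (real k * x))\<^sup>2
      = (\<Sum>k\<le>d. \<Sum>l\<le>d. u k * u l * cos (real l * x - real k * x))"
    by (simp add: power2_eq_square sum_product sum.distrib[symmetric] cos_diff algebra_simps)
  also have "\<dots> = (\<Sum>k\<le>d. u k * u k * cos (real k * x - real k * x))
      + 2 * (\<Sum>j=1..d. \<Sum>k\<le>d-j. u k * u (k + j) * cos (real (k + j) * x - real k * x))"
  proof (rule sum_symmetric_by_diagonals)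
    fix k l
    show "u k * u l * cos (real l * x - real k * x) = u l * u k * cos (real k * x - real l * x)"
      by (subst cos_minus[symmetric]) (simp del: cos_minus)
  qed
  also have "(\<Sum>k\<le>d. u k * u k * cos (real k * x - real k * x)) = (real d + 2) / 2"
    using jackson_damping_autocorrelation[of 0 d] by (simp add: u_def)
  also have "(\<Sum>j=1..d. \<Sum>k\<le>d-j. u k * u (k + j) * cos (real (k + j) * x - real k * x))
      = (\<Sum>j=1..d. (real d + 2) / 2 * jackson_damping j d * cos (real j * x))"
  proof (rule sum.cong[OF refl])
    fix j assume "j \<in> {1..d}"
    then have "j \<le> d" by simp
    have "(\<Sum>k\<le>d-j. u k * u (k + j) * cos (real (k + j) * x - real k * x))
        = (\<Sum>k\<le>d-j. u k * u (k + j)) * cos (real j * x)"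
      by (simp add: sum_distrib_left algebra_simps)
    then show "(\<Sum>k\<le>d-j. u k * u (k + j) * cos (real (k + j) * x - real k * x))
        = (real d + 2) / 2 * jackson_damping j d * cos (real j * x)"
      using jackson_damping_autocorrelation[OF \<open>j \<le> d\<close>] by (simp add: u_def)
  qed
  also have "(real d + 2) / 2 + 2 * (\<Sum>j=1..d. (real d + 2) / 2 * jackson_damping j d * cos (real j * x))
      = (real d + 2) * jackson_kernel d x"
    by (simp only: jackson_kernel_def mult.assoc sum_distrib_left[symmetric]) (simp add: field_simps)
  finally have "0 \<le> (real d + 2) * jackson_kernel d x"
    by (metis sum_power2_ge_zero)
  then show ?thesis by (simp add: zero_le_mult_iff)
qed

lemma jackson_kernel_minus: "jackson_kernel d (- x) = jackson_kernel d x"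
  by (simp add: jackson_kernel_def)

lemma continuous_on_jackson_kernel [continuous_intros]:
  fixes f :: "real \<Rightarrow> real"
  shows "continuous_on S f \<Longrightarrow> continuous_on S (\<lambda>x. jackson_kernel d (f x))"
  unfolding jackson_kernel_def by (auto intro!: continuous_intros)

section \<open>Moments of the kernel\<close>

text \<open>Integrating \<open>f (\<theta> - \<phi>) + f (\<theta> + \<phi>)\<close> over half a period reads off the mean
  value of an even trigonometric polynomial \<open>f\<close>, without any periodicity argument.\<close>

lemma has_integral_folded_cos:
  fixes i :: int and \<theta> :: real
  shows "((\<lambda>\<phi>. cos (of_int i * (\<theta> - \<phi>)) + cos (of_int i * (\<theta> + \<phi>)))
          has_integral (if i = 0 then 2 * pi else 0)) {0..pi}"
proof (cases "i = 0")
  case True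
  then show ?thesis using has_integral_const_real[of "2::real" 0 pi] by (simp add: mult.commute)
next
  case False
  have "((\<lambda>\<phi>. cos (of_int i * (\<theta> - \<phi>)) + cos (of_int i * (\<theta> + \<phi>))) has_integral
      ((sin (of_int i * (\<theta> + pi)) - sin (of_int i * (\<theta> - pi))) / of_int i
       - (sin (of_int i * (\<theta> + 0)) - sin (of_int i * (\<theta> - 0))) / of_int i)) {0..pi}"
    using False
    by (intro fundamental_theorem_of_calculus)
       (auto intro!: derivative_eq_intros simp: has_real_derivative_iff_has_vector_derivative[symmetric] field_simps)
  moreover have "sin (of_int i * (\<theta> + pi)) - sin (of_int i * (\<theta> - pi)) = 0"
    using sin_int_times_real[of i] 
    by (simp add: distrib_left right_diff_distrib sin_add sin_diff mult.commute[of _ pi])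
  ultimately show ?thesis using False by simp
qed

text \<open>Orthogonality of cosines. The product splits into the integer frequencies m - j,
  possibly negative, and m + j; both vanish only for m = j = 0, whence the doubled value.\<close>

lemma has_integral_folded_cos_cos:
  fixes m j :: nat and \<theta> :: real
  shows "((\<lambda>\<phi>. cos (real m * (\<theta> - \<phi>)) * cos (real j * (\<theta> - \<phi>))
             + cos (real m * (\<theta> + \<phi>)) * cos (real j * (\<theta> + \<phi>)))
          has_integral (if j = m then if m = 0 then 2 * pi else pi else 0)) {0..pi}"
proof -
  have "((\<lambda>\<phi>. ((cos (of_int (int m - int j) * (\<theta> - \<phi>)) + cos (of_int (int m - int j) * (\<theta> + \<phi>)))
           + (cos (of_int (int m + int j) * (\<theta> - \<phi>)) + cos (of_int (int m + int j) * (\<theta> + \<phi>)))) / 2)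
        has_integral ((if int m - int j = 0 then 2 * pi else 0)
           + (if int m + int j = 0 then 2 * pi else 0)) / 2) {0..pi}"
    by (intro has_integral_divide has_integral_add has_integral_folded_cos)
  then show ?thesis
    by (rule has_integral_eq_rhs[OF has_integral_eq[rotated]])
       (auto simp: cos_times_cos left_diff_distrib distrib_right add_divide_distrib)
qed

text \<open>Orthogonality isolates the \<open>m\<close>-th coefficient, which occurs in the kernel
  because \<open>m \<le> d\<close>. For \<open>m = 0\<close> the constant term 1/2 offsets the
  doubled integral.\<close>

lemma has_integral_folded_jackson_kernel:
  assumes "m \<le> d"
  shows "((\<lambda>\<phi>. cos (real m * (\<theta> - \<phi>)) * jackson_kernel d (\<theta> - \<phi>)
             + cos (real m * (\<theta> + \<phi>)) * jackson_kernel d (\<theta> + \<phi>))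
          has_integral (pi * jackson_damping m d)) {0..pi}"
proof -
  let ?C = "\<lambda>j \<phi>. cos (real m * (\<theta> - \<phi>)) * cos (real j * (\<theta> - \<phi>))
             + cos (real m * (\<theta> + \<phi>)) * cos (real j * (\<theta> + \<phi>))"
  let ?I = "\<lambda>j. if j = m then if m = 0 then 2 * pi else pi else 0"
  have "((\<lambda>\<phi>. 1 / 2 * ?C 0 \<phi> + (\<Sum>j=1..d. jackson_damping j d * ?C j \<phi>)) has_integral
        1 / 2 * ?I 0 + (\<Sum>j=1..d. jackson_damping j d * ?I j)) {0..pi}"
    by (intro has_integral_add has_integral_sum has_integral_mult_right has_integral_folded_cos_cos) auto
  moreover have "1 / 2 * ?I 0 + (\<Sum>j=1..d. jackson_damping j d * ?I j) = pi * jackson_damping m d"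
  proof (cases "m = 0")
    case False
    have "(\<Sum>j=1..d. jackson_damping j d * ?I j) = (\<Sum>j=1..d. if j = m then jackson_damping j d * pi else 0)"
      using False by (intro sum.cong) auto
    also have "\<dots> = jackson_damping m d * pi" using False assms by (simp add: sum.delta)
    finally show ?thesis using False by simp
  qed (auto intro!: sum.neutral)
  moreover have "1 / 2 * ?C 0 \<phi> + (\<Sum>j=1..d. jackson_damping j d * ?C j \<phi>)
     = cos (real m * (\<theta> - \<phi>)) * jackson_kernel d (\<theta> - \<phi>)
             + cos (real m * (\<theta> + \<phi>)) * jackson_kernel d (\<theta> + \<phi>)" for \<phi>
    by (simp add: jackson_kernel_def sum_distrib_left sum.distrib[symmetric] algebra_simps)
  ultimately show ?thesis by (simp only:)
qed

lemma has_integral_folded_kernel_moment1: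
  assumes "1 \<le> d"
  shows "((\<lambda>\<phi>. (1 - cos (\<theta> - \<phi>)) * jackson_kernel d (\<theta> - \<phi>)
             + (1 - cos (\<theta> + \<phi>)) * jackson_kernel d (\<theta> + \<phi>))
          has_integral (pi * (1 - cos (jackson_angle d)))) {0..pi}"
  using has_integral_diff[OF has_integral_folded_jackson_kernel[of 0 d \<theta>]
      has_integral_folded_jackson_kernel[of 1 d \<theta>]] assms
  by (simp add: jackson_damping_1[unfolded One_nat_def] algebra_simps)

text \<open>Expand (1 - cos x)^2 = 3/2 - 2 cos x + cos(2x)/2 and integrate against the kernel; the
  frequency 2 is where \<open>2 \<le> d\<close> enters.\<close>

lemma has_integral_folded_kernel_moment2:
  assumes "2 \<le> d"
  shows "((\<lambda>\<phi>. (1 - cos (\<theta> - \<phi>))\<^sup>2 * jackson_kernel d (\<theta> - \<phi>)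
             + (1 - cos (\<theta> + \<phi>))\<^sup>2 * jackson_kernel d (\<theta> + \<phi>))
          has_integral (pi * ((1 - cos (jackson_angle d))\<^sup>2
             + (sin (jackson_angle d))\<^sup>2 / (real d + 2)))) {0..pi}"
proof -
  let ?C = "\<lambda>m \<phi>. cos (real m * (\<theta> - \<phi>)) * jackson_kernel d (\<theta> - \<phi>)
             + cos (real m * (\<theta> + \<phi>)) * jackson_kernel d (\<theta> + \<phi>)"
  have "((\<lambda>\<phi>. 3 / 2 * ?C 0 \<phi> - 2 * ?C 1 \<phi> + 1 / 2 * ?C 2 \<phi>) has_integral
     3 / 2 * (pi * jackson_damping 0 d) - 2 * (pi * jackson_damping 1 d)
       + 1 / 2 * (pi * jackson_damping 2 d)) {0..pi}"
    using assms
    by (intro has_integral_add has_integral_diff has_integral_mult_right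
        has_integral_folded_jackson_kernel) auto
  moreover have "3 / 2 * ?C 0 \<phi> - 2 * ?C 1 \<phi> + 1 / 2 * ?C 2 \<phi>
     = (1 - cos (\<theta> - \<phi>))\<^sup>2 * jackson_kernel d (\<theta> - \<phi>)
             + (1 - cos (\<theta> + \<phi>))\<^sup>2 * jackson_kernel d (\<theta> + \<phi>)" for \<phi>
  proof -
    have "cos (real 2 * x) = 2 * (cos x)\<^sup>2 - 1" for x :: real
      by (simp add: cos_double_cos)
    then show ?thesis by (simp only:) (simp add: power2_eq_square algebra_simps)
  qed
  moreover have "3 / 2 * (pi * jackson_damping 0 d) - 2 * (pi * jackson_damping 1 d)
       + 1 / 2 * (pi * jackson_damping 2 d)
     = pi * ((1 - cos (jackson_angle d))\<^sup>2 + (sin (jackson_angle d))\<^sup>2 / (real d + 2))"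
    unfolding jackson_damping_1 jackson_damping_2 jackson_damping_0
    unfolding cos_double_cos by (simp add: power2_eq_square algebra_simps add_divide_distrib)
  ultimately show ?thesis by (simp only:)
qed

section \<open>Derivatives of p(cos x) and the integral form of q_d\<close>

text \<open>The \<open>m\<close>-th derivative of \<open>x \<mapsto> p(cos x)\<close>, meaningful only for \<open>m \<le> 2\<close>.\<close>

definition poly_cos_deriv :: "real poly \<Rightarrow> nat \<Rightarrow> real \<Rightarrow> real" where
  "poly_cos_deriv p m x =
     (if m = 0 then poly p (cos x)
      else if m = 1 then - sin x * poly (pderiv p) (cos x)
      else (sin x)\<^sup>2 * poly (pderiv (pderiv p)) (cos x) - cos x * poly (pderiv p) (cos x))"

lemma has_real_derivative_poly_cos_deriv:
  "m < 2 \<Longrightarrow> (poly_cos_deriv p m has_real_derivative poly_cos_deriv p (Suc m) x) (at x within S)"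
  by (auto simp: less_2_cases_iff poly_cos_deriv_def[abs_def] power2_eq_square
      intro!: derivative_eq_intros)

text \<open>The substitution x = arccos t absorbs the weight, which is minus the derivative of
  \<open>arccos\<close>. That derivative is available only away from -1 and 1, so these points form
  the exceptional set.\<close>

lemma cheb_coeff_eq_cos_integral:
  assumes "-1 \<le> a" "a < b" "b \<le> 1"
  shows "cheb_coeff p a b j
         = 2 / pi * integral {arccos b..arccos a} (\<lambda>x. poly p (cos x) * cos (real j * x))"
proof -
  define f where "f x = poly p (cos x) * cos (real j * x)" for x
  have le: "arccos b < arccos a"
    using assms by (intro arccos_less_arccos) auto
  \<comment> \<open>As \<open>arccos\<close> is decreasing, the first of the two integrals is over
    an empty interval; the second survives with a minus sign.\<close>
  have "((\<lambda>t. - inverse (sqrt (1 - t\<^sup>2)) *\<^sub>R f (arccos t)) has_integral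
      (integral {arccos a..arccos b} f - integral {arccos b..arccos a} f)) {a..b}"
  proof (rule has_integral_substitution_general[where s = "{-1, 1}" and c = 0 and d = pi])
    show "arccos ` {a..b} \<subseteq> {0..pi}"
      using assms by (auto intro!: arccos_lbound arccos_ubound)
    show "continuous_on {0..pi} f"
      unfolding f_def by (intro continuous_intros)
    show "continuous_on {a..b} arccos"
      using assms by (intro continuous_on_subset[OF continuous_on_arccos']) auto
    fix x assume "x \<in> {a..b} - {-1, 1}"
    then have "-1 < x" "x < 1" using assms by auto
    from DERIV_arccos[OF this]
    show "(arccos has_real_derivative - inverse (sqrt (1 - x\<^sup>2))) (at x within {a..b})"
      by (auto intro: has_field_derivative_at_within)
  qed (use assms in auto)
  from has_integral_neg[OF this]
  have "((\<lambda>t. inverse (sqrt (1 - t\<^sup>2)) * f (arccos t)) has_integral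
      integral {arccos b..arccos a} f) {a..b}"
    using le by simp
  then have "((\<lambda>t. poly p t * poly (cheb_T j) t / sqrt (1 - t\<^sup>2)) has_integral
      integral {arccos b..arccos a} f) {a..b}"
  proof (rule has_integral_eq[rotated])
    fix t assume "t \<in> {a..b}"
    then have "cos (arccos t) = t" using assms by auto
    then show "inverse (sqrt (1 - t\<^sup>2)) * f (arccos t) = poly p t * poly (cheb_T j) t / sqrt (1 - t\<^sup>2)"
      using poly_cheb_T_cos[of j "arccos t"] by (simp add: f_def divide_inverse)
  qed
  then show ?thesis
    unfolding cheb_coeff_def f_def by (simp add: integral_unique)
qed

text \<open>The two kernel terms come from folding the even function g onto [0, pi]. Their sum
  leaves only products \<open>cos (j \<theta>) cos (j x)\<close>, which are integrated
  termwise.\<close>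

lemma q_fun_eq_kernel_integral:
  assumes "-1 \<le> a" "a < b" "b \<le> 1"
  shows "((\<lambda>x. poly p (cos x) * (jackson_kernel d (\<theta> - x) + jackson_kernel d (\<theta> + x)))
          has_integral pi * q_fun d p a b \<theta>) {arccos b..arccos a}"
proof -
  let ?I = "{arccos b..arccos a}"
  let ?c = "\<lambda>j. integral ?I (\<lambda>x. poly p (cos x) * cos (real j * x))"
  have *: "((\<lambda>x. poly p (cos x) * cos (real j * x)) has_integral ?c j) ?I" for j
    by (intro integrable_integral integrable_continuous_interval continuous_intros)
  have "((\<lambda>x. poly p (cos x) * cos (real 0 * x)
      + (\<Sum>j=1..d. 2 * jackson_damping j d * cos (real j * \<theta>) * (poly p (cos x) * cos (real j * x))))
     has_integral ?c 0 + (\<Sum>j=1..d. 2 * jackson_damping j d * cos (real j * \<theta>) * ?c j)) ?I"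
    by (intro has_integral_add has_integral_sum has_integral_mult_right *) auto
  moreover have "?c 0 + (\<Sum>j=1..d. 2 * jackson_damping j d * cos (real j * \<theta>) * ?c j)
      = pi * q_fun d p a b \<theta>"
    using assms
    by (simp add: q_fun_def cheb_jackson_def cheb_coeff_eq_cos_integral poly_cheb_T_cos
        distrib_left sum_distrib_left mult_ac)
  moreover have "jackson_kernel d (\<theta> - x) + jackson_kernel d (\<theta> + x)
      = 1 + (\<Sum>j=1..d. 2 * jackson_damping j d * cos (real j * \<theta>) * cos (real j * x))" for x
    by (simp add: jackson_kernel_def sum.distrib[symmetric] distrib_left right_diff_distrib
        cos_add cos_diff mult.assoc)
  ultimately show ?thesis
    by (simp add: distrib_left sum_distrib_left mult_ac)
qed

section \<open>Cancellation of odd terms and estimates for 1 - cos\<close>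

lemma has_integral_odd_about:
  fixes u :: "real \<Rightarrow> real"
  assumes odd: "\<And>x. u (- x) = - u x" and cont: "continuous_on {-r..r} u"
  shows "((\<lambda>x. u (x - c)) has_integral 0) {c - r..c + r}"
proof -
  have "u integrable_on {-r..r}"
    using cont by (rule integrable_continuous_interval)
  moreover have "integral {-r..r} u = 0"
    using Henstock_Kurzweil_Integration.integral_reflect_real[of r "-r" u] by (simp add: odd)
  ultimately have "(u has_integral 0) {-r..r}"
    by (metis integrable_integral)
  then show ?thesis
    using has_integral_affinity'[of u 0 "-r" r 1 "-c"] by (simp add: add.commute)
qed

text \<open>Jordan's inequality, squared, in 1 - cos y = 2 sin(y/2)^2. Reflection at pi covers
  arguments beyond pi, which occur for \<theta> + x.\<close>

lemma one_minus_cos_ge: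
  fixes r x :: real
  assumes "0 \<le> r" "r \<le> x" "x \<le> 2 * pi - r"
  shows "2 * r\<^sup>2 / pi\<^sup>2 \<le> 1 - cos x"
proof -
  have aux: "2 * r\<^sup>2 / pi\<^sup>2 \<le> 1 - cos y" if "r \<le> y" "y \<le> pi" for y
  proof -
    have "concave_on {0..pi / 2} sin"
      by (rule f''_le0_imp_concave[where f' = cos and f'' = "\<lambda>x. - sin x"])
         (auto intro!: derivative_eq_intros sin_ge_zero)
    \<comment> \<open>The chord of the sine over [0, pi/2], taken at weight \<open>y / pi\<close>,
      is the line through 0 with value \<open>y / pi\<close> at \<open>y / 2\<close>.\<close>
    from concave_onD_Icc[OF this, of "y / pi"] have "y / pi \<le> sin (y / 2)"
      using that assms by (simp add: divide_le_eq_1)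
    moreover have "r / pi \<le> y / pi" using that by (simp add: divide_right_mono)
    ultimately have "(r / pi)\<^sup>2 \<le> (sin (y / 2))\<^sup>2"
      using assms by (intro power_mono) auto
    moreover have "1 - cos y = 2 * (sin (y / 2))\<^sup>2"
      using cos_double_sin[of "y / 2"] by simp
    ultimately show ?thesis by (simp add: power_divide)
  qed
  show ?thesis
  proof (cases "x \<le> pi")
    case False
    then show ?thesis using aux[of "2 * pi - x"] assms by (simp add: cos_diff)
  qed (use aux assms in auto)
qed
lemma one_minus_cos_jackson_angle_le:
  "1 - cos (jackson_angle d) \<le> pi\<^sup>2 / (2 * (real d + 2)\<^sup>2)"
proof -
  have "(sin (jackson_angle d / 2))\<^sup>2 \<le> (jackson_angle d / 2)\<^sup>2"
    using abs_sin_x_le_abs_x by (rule abs_le_square_iff[THEN iffD1])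
  moreover have "1 - cos (jackson_angle d) = 2 * (sin (jackson_angle d / 2))\<^sup>2"
    using cos_double_sin[of "jackson_angle d / 2"] by simp
  moreover have "2 * (jackson_angle d / 2)\<^sup>2 = (jackson_angle d)\<^sup>2 / 2"
    by (simp add: power_divide)
  ultimately have "1 - cos (jackson_angle d) \<le> (jackson_angle d)\<^sup>2 / 2"
    by linarith
  then show ?thesis by (simp add: jackson_angle_def power_divide mult.commute)
qed

lemma jackson_kernel_moment2_le:
  assumes "2 \<le> d"
  shows "(1 - cos (jackson_angle d))\<^sup>2 + (sin (jackson_angle d))\<^sup>2 / (real d + 2)
         \<le> 2 * pi\<^sup>2 / (real d + 2) ^ 3"
proof -
  define N where "N = real d + 2"
  have N: "4 \<le> N" "0 < N" using assms by (simp_all add: N_def)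
  have "(1 - cos (jackson_angle d))\<^sup>2 \<le> (pi\<^sup>2 / (2 * N\<^sup>2))\<^sup>2"
    using one_minus_cos_jackson_angle_le[of d] by (intro power_mono) (auto simp: N_def)
  also have "\<dots> = pi\<^sup>2 * pi\<^sup>2 / (4 * N ^ 4)"
    by (simp add: power_divide power_mult_distrib flip: power_mult power_add)
  \<comment> \<open>One power of \<open>N\<close> is traded for a constant through pi^2 \<le> 16
    \<le> 4N, which uses \<open>d \<ge> 2\<close>.\<close>
  also have "\<dots> \<le> pi\<^sup>2 * (4 * N) / (4 * N ^ 4)"
  proof (intro divide_right_mono mult_left_mono)
    have "pi\<^sup>2 \<le> 4\<^sup>2" using pi_less_4 by (intro power_mono) auto
    then show "pi\<^sup>2 \<le> 4 * N" using N by simp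
  qed (use N in auto)
  also have "\<dots> = pi\<^sup>2 / N ^ 3"
    using N by (simp add: field_simps eval_nat_numeral)
  finally have 1: "(1 - cos (jackson_angle d))\<^sup>2 \<le> pi\<^sup>2 / N ^ 3" .
  have "(sin (jackson_angle d))\<^sup>2 \<le> (jackson_angle d)\<^sup>2"
    using abs_sin_x_le_abs_x by (rule abs_le_square_iff[THEN iffD1])
  then have "(sin (jackson_angle d))\<^sup>2 / N \<le> (jackson_angle d)\<^sup>2 / N"
    using N by (intro divide_right_mono) auto
  also have "\<dots> = pi\<^sup>2 / N ^ 3"
    by (simp add: jackson_angle_def N_def power_divide eval_nat_numeral)
  finally show ?thesis using 1 by (simp add: N_def)
qed

section \<open>Supremum norms, derivatives of g and the Taylor bound\<close>

text \<open>A real supremum is an upper bound only for a set bounded above; \<open>C\<close>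
  provides this.\<close>

lemma abs_le_sup_norm_on:
  assumes "\<And>y. y \<in> {l<..<r} \<Longrightarrow> \<bar>f y\<bar> \<le> C" and "x \<in> {l<..<r}"
  shows "\<bar>f x\<bar> \<le> sup_norm_on l r f"
  unfolding sup_norm_on_def using assms by (intro cSUP_upper bdd_aboveI2) auto

lemma abs_g_fun_le_sup_norm:
  assumes "x \<in> {0<..<pi}"
  shows "\<bar>g_fun p a b x\<bar> \<le> sup_norm_on 0 pi (g_fun p a b)"
proof -
  have "bounded (poly p ` {-1..1})"
    by (intro compact_imp_bounded compact_continuous_image continuous_intros compact_Icc)
  then obtain C where C: "\<forall>t\<in>poly p ` {-1..1}. \<bar>t\<bar> \<le> C"
    by (auto simp: bounded_real)
  have "\<bar>g_fun p a b y\<bar> \<le> C" for y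
    using bspec[OF C, of "poly p (cos y)"] by (auto simp: g_fun_def windowed_poly_def window_def abs_mult)
  then show ?thesis by (rule abs_le_sup_norm_on) (rule assms)
qed

lemma g_fun_eq_poly_cos:
  assumes "-1 \<le> a" "a < b" "b \<le> 1" "x \<in> {arccos b<..<arccos a}"
  shows "g_fun p a b x = poly p (cos x)"
proof -
  have "0 \<le> arccos b" "arccos a \<le> pi"
    using assms by (auto intro!: arccos_lbound arccos_ubound)
  then have "cos (arccos a) < cos x" "cos x < cos (arccos b)"
    using assms by (intro cos_monotone_0_pi; simp)+
  then show ?thesis using assms by (simp add: g_fun_def windowed_poly_def window_def)
qed

text \<open>Differentiation is local, and g agrees with p(cos x) on the whole open interval, so the
  first derivatives agree there as well and can be differentiated again.\<close>

lemma deriv_deriv_g_fun: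
  assumes "-1 \<le> a" "a < b" "b \<le> 1" "x \<in> {arccos b<..<arccos a}"
  shows "deriv (deriv (g_fun p a b)) x = poly_cos_deriv p 2 x"
proof -
  let ?I = "{arccos b<..<arccos a}"
  have *: "deriv f y = poly_cos_deriv p (Suc m) y"
    if "m < 2" "y \<in> ?I" "\<And>z. z \<in> ?I \<Longrightarrow> f z = poly_cos_deriv p m z" for f m y
    using that(3)[symmetric]
    by (intro DERIV_imp_deriv has_field_derivative_transform_within_open[
          OF has_real_derivative_poly_cos_deriv[OF that(1)] open_greaterThanLessThan that(2)])
  have "deriv (g_fun p a b) y = poly_cos_deriv p 1 y" if "y \<in> ?I" for y
    using *[of 0 y "g_fun p a b"] that g_fun_eq_poly_cos[OF assms(1-3)] by (simp add: poly_cos_deriv_def)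
  then show ?thesis
    using *[of 1 x "deriv (g_fun p a b)"] assms(4) by (simp add: numeral_2_eq_2)
qed

lemma abs_poly_cos_deriv_2_le_sup_norm:
  assumes "-1 \<le> a" "a < b" "b \<le> 1" "x \<in> {arccos b<..<arccos a}"
  shows "\<bar>poly_cos_deriv p 2 x\<bar> \<le> sup_norm_on (arccos b) (arccos a) (deriv (deriv (g_fun p a b)))"
proof -
  let ?I = "{arccos b..arccos a}"
  have "continuous_on ?I (poly_cos_deriv p 2)"
    unfolding poly_cos_deriv_def[abs_def] by (auto intro!: continuous_intros)
  then have "bounded (poly_cos_deriv p 2 ` ?I)"
    by (intro compact_imp_bounded compact_continuous_image compact_Icc)
  then obtain C where C: "\<forall>y\<in>?I. \<bar>poly_cos_deriv p 2 y\<bar> \<le> C"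
    by (auto simp: bounded_real)
  have "\<bar>deriv (deriv (g_fun p a b)) y\<bar> \<le> C" if "y \<in> {arccos b<..<arccos a}" for y
    using bspec[OF C, of y] that deriv_deriv_g_fun[OF assms(1-3) that] by simp
  then have "\<bar>deriv (deriv (g_fun p a b)) x\<bar>
      \<le> sup_norm_on (arccos b) (arccos a) (deriv (deriv (g_fun p a b)))"
    by (rule abs_le_sup_norm_on) (use assms(4) in auto)
  then show ?thesis
    using deriv_deriv_g_fun[OF assms] by simp
qed

text \<open>The Lagrange remainder is evaluated strictly between \<open>x\<close> and
  \<open>y\<close>, hence inside the open interval even if \<open>x\<close> is an endpoint.\<close>

lemma poly_cos_taylor_bound:
  fixes x y l u B :: real
  assumes B: "\<And>t. t \<in> {l<..<u} \<Longrightarrow> \<bar>poly_cos_deriv p 2 t\<bar> \<le> B"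
    and "x \<in> {l..u}" "y \<in> {l<..<u}"
  shows "\<bar>poly p (cos x) - poly p (cos y) - poly_cos_deriv p 1 y * (x - y)\<bar> \<le> B / 2 * (x - y)\<^sup>2"
proof (cases "x = y")
  case False
  have "\<exists>t. (if x < y then x < t \<and> t < y else y < t \<and> t < x) \<and>
      poly_cos_deriv p 0 x = (\<Sum>m<2. poly_cos_deriv p m y / fact m * (x - y) ^ m) + poly_cos_deriv p 2 t / fact 2 * (x - y)\<^sup>2"
    using assms False by (intro Taylor[where a = l and b = u]) (auto intro: has_real_derivative_poly_cos_deriv)
  then obtain t where t: "if x < y then x < t \<and> t < y else y < t \<and> t < x"
    and eq: "poly_cos_deriv p 0 x = (\<Sum>m<2. poly_cos_deriv p m y / fact m * (x - y) ^ m) + poly_cos_deriv p 2 t / fact 2 * (x - y)\<^sup>2"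
    by blast
  have "t \<in> {l<..<u}" using t assms by (auto split: if_splits)
  then have "\<bar>poly_cos_deriv p 2 t\<bar> / 2 * (x - y)\<^sup>2 \<le> B / 2 * (x - y)\<^sup>2"
    using B by (intro mult_right_mono divide_right_mono) auto
  moreover have *: "poly p (cos x) - poly p (cos y) - poly_cos_deriv p 1 y * (x - y) = poly_cos_deriv p 2 t / 2 * (x - y)\<^sup>2"
    using eq by (simp add: numeral_2_eq_2 poly_cos_deriv_def[of p 0])
  ultimately show ?thesis unfolding * by (simp add: abs_mult)
qed simp

section \<open>The error estimate\<close>

theorem theorem3p5:
  fixes a b \<alpha> \<beta> \<theta> :: real and p :: "real poly" and M d :: nat
  assumes "-1 \<le> a" and "a < b" and "b \<le> 1"
    and "M \<ge> 1" and "degree p \<le> M - 1"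
    and "d \<ge> 2"
    and "\<alpha> = arccos a" and "\<beta> = arccos b"
    and "\<theta> \<in> {\<beta><..<\<alpha>}"
  shows "\<bar>q_fun d p a b \<theta> - g_fun p a b \<theta>\<bar>
    \<le> pi ^ 6 * sup_norm_on 0 pi (g_fun p a b)
        / ((min \<bar>\<theta> - \<alpha>\<bar> \<bar>\<theta> - \<beta>\<bar>) ^ 4 * (real d + 2) ^ 3)
      + pi ^ 4 * sup_norm_on \<beta> \<alpha> (deriv (deriv (g_fun p a b)))
        / (8 * (real d + 2) ^ 2)"
proof -
  note ab = assms(1-3)
  let ?K = "jackson_kernel d"
  define P where "P x = poly p (cos x)" for x
  \<comment> \<open>\<open>G\<close> takes the value 0 at \<alpha> and \<beta> instead of the half
    values of g; finitely many points do not affect the integrals.\<close>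
  define G where "G x = (if \<beta> < x \<and> x < \<alpha> then P x else 0)" for x
  define A where "A = sup_norm_on 0 pi (g_fun p a b)"
  define B where "B = sup_norm_on \<beta> \<alpha> (deriv (deriv (g_fun p a b)))"
  define r where "r = min \<bar>\<theta> - \<alpha>\<bar> \<bar>\<theta> - \<beta>\<bar>"
  define N where "N = real d + 2"
  \<comment> \<open>The constants are fitted to 1 - cos h \<ge> 2h^2/pi^2: they satisfy
    \<open>c\<^sub>1 * (2 * h^2 / pi^2) = B / 2 * h^2\<close> and
    \<open>c\<^sub>2 * (2 * r^2 / pi^2)^2 = 2 * A\<close>.\<close>
  define c\<^sub>1 where "c\<^sub>1 = pi\<^sup>2 * B / 4"
  define c\<^sub>2 where "c\<^sub>2 = pi ^ 4 * A / (2 * r ^ 4)"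
  \<comment> \<open>The linear Taylor term, cut off to an interval symmetric about \<theta> so that
    its integral against the even kernel vanishes.\<close>
  define L where "L x = (if \<bar>x - \<theta>\<bar> \<le> r then poly_cos_deriv p 1 \<theta> * (x - \<theta>) else 0)" for x
  have range: "0 \<le> \<beta>" "\<alpha> \<le> pi" "\<beta> < \<theta>" "\<theta> < \<alpha>"
    using assms by (auto intro!: arccos_lbound arccos_ubound)
  then have r: "0 < r" "r \<le> \<theta> - \<beta>" "r \<le> \<alpha> - \<theta>"
    by (auto simp: r_def)
  have N: "0 < N" by (simp add: N_def)
  have g: "g_fun p a b x = P x" if "\<beta> < x" "x < \<alpha>" for x
    using g_fun_eq_poly_cos[OF ab] that assms(7,8) by (simp add: P_def)
  have A: "\<bar>P x\<bar> \<le> A" if "\<beta> < x" "x < \<alpha>" for x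
    using abs_g_fun_le_sup_norm[of x p a b] g[OF that] that range by (simp add: A_def)
  have B: "\<bar>poly_cos_deriv p 2 x\<bar> \<le> B" if "x \<in> {\<beta><..<\<alpha>}" for x
    using abs_poly_cos_deriv_2_le_sup_norm[OF ab] that assms(7,8) by (simp add: B_def)
  have "0 \<le> A" "0 \<le> B" using A[of \<theta>] B[of \<theta>] range by auto
  then have c: "0 \<le> c\<^sub>1" "0 \<le> c\<^sub>2" by (simp_all add: c\<^sub>1_def c\<^sub>2_def)

  \<comment> \<open>\<open>v\<close> stands for 1 - cos of \<theta> - x or \<theta> + x; the term
    with \<open>v^2\<close> alone absorbs the crude bound \<open>2 * A\<close>.\<close>
  have far: "\<bar>G x - P \<theta>\<bar> \<le> c\<^sub>1 * v + c\<^sub>2 * v\<^sup>2" if "2 * r\<^sup>2 / pi\<^sup>2 \<le> v" for x v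
  proof -
    have "0 \<le> 2 * r\<^sup>2 / pi\<^sup>2" by simp
    then have "0 \<le> v" using that by linarith
    have "(2 * r\<^sup>2 / pi\<^sup>2)\<^sup>2 \<le> v\<^sup>2" using that by (intro power_mono) auto
    then have "c\<^sub>2 * (2 * r\<^sup>2 / pi\<^sup>2)\<^sup>2 \<le> c\<^sub>2 * v\<^sup>2" using c by (intro mult_left_mono)
    moreover have "c\<^sub>2 * (2 * r\<^sup>2 / pi\<^sup>2)\<^sup>2 = 2 * A"
      using r by (simp add: c\<^sub>2_def power_divide power_mult_distrib)
    moreover have "\<bar>G x - P \<theta>\<bar> \<le> 2 * A"
      using A[of x] A[of \<theta>] range \<open>0 \<le> A\<close> by (auto simp: G_def)
    moreover have "0 \<le> c\<^sub>1 * v" using c \<open>0 \<le> v\<close> by simp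
    ultimately show ?thesis by linarith
  qed
  \<comment> \<open>The points \<alpha> and \<beta> are excluded because \<open>G\<close> is 0
    there, while the Taylor formula describes \<open>P\<close>.\<close>
  have minus: "\<bar>G x - P \<theta> - L x\<bar> \<le> c\<^sub>1 * (1 - cos (\<theta> - x)) + c\<^sub>2 * (1 - cos (\<theta> - x))\<^sup>2"
    if "0 < x" "x < pi" "x \<noteq> \<beta>" "x \<noteq> \<alpha>" for x
  proof (cases "\<bar>x - \<theta>\<bar> \<le> r")
    case True
    then have "x \<in> {\<beta>..\<alpha>}" using r by auto
    then have "G x = P x" using that by (auto simp: G_def)
    have "2 * \<bar>\<theta> - x\<bar>\<^sup>2 / pi\<^sup>2 \<le> 1 - cos \<bar>\<theta> - x\<bar>"
      using range that by (intro one_minus_cos_ge) auto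
    then have "c\<^sub>1 * (2 * (x - \<theta>)\<^sup>2 / pi\<^sup>2) \<le> c\<^sub>1 * (1 - cos (\<theta> - x))"
      using c by (intro mult_left_mono) (auto simp: power2_commute)
    moreover have "c\<^sub>1 * (2 * (x - \<theta>)\<^sup>2 / pi\<^sup>2) = B / 2 * (x - \<theta>)\<^sup>2"
      by (simp add: c\<^sub>1_def)
    moreover have "\<bar>P x - P \<theta> - poly_cos_deriv p 1 \<theta> * (x - \<theta>)\<bar> \<le> B / 2 * (x - \<theta>)\<^sup>2"
      unfolding P_def using B \<open>x \<in> {\<beta>..\<alpha>}\<close> assms(9) by (rule poly_cos_taylor_bound)
    moreover have "0 \<le> c\<^sub>2 * (1 - cos (\<theta> - x))\<^sup>2" using c by simp
    ultimately show ?thesis using True \<open>G x = P x\<close> by (simp add: L_def)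
  next
    case False
    have "2 * r\<^sup>2 / pi\<^sup>2 \<le> 1 - cos \<bar>\<theta> - x\<bar>"
      using False range r that by (intro one_minus_cos_ge) auto
    then show ?thesis using far[of "1 - cos (\<theta> - x)" x] False by (simp add: L_def)
  qed
  \<comment> \<open>The mirror point -x is always far: \<open>r\<close> is at most both \<theta> and
    pi - \<theta>, so \<theta> + x lies between \<open>r\<close> and 2 pi -
    \<open>r\<close>.\<close>
  have plus: "\<bar>G x - P \<theta>\<bar> \<le> c\<^sub>1 * (1 - cos (\<theta> + x)) + c\<^sub>2 * (1 - cos (\<theta> + x))\<^sup>2"
    if "0 < x" "x < pi" for x
    using range r that by (intro far one_minus_cos_ge) auto

  \<comment> \<open>\<open>D\<close> is the folded error integrand with the linear term removed;
    \<open>R\<close> is its majorant, built from the two kernel moments.\<close>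
  define D where "D x = (G x - P \<theta> - L x) * ?K (\<theta> - x) + (G x - P \<theta>) * ?K (\<theta> + x)" for x
  define R where "R x = c\<^sub>1 * ((1 - cos (\<theta> - x)) * ?K (\<theta> - x) + (1 - cos (\<theta> + x)) * ?K (\<theta> + x))
     + c\<^sub>2 * ((1 - cos (\<theta> - x))\<^sup>2 * ?K (\<theta> - x) + (1 - cos (\<theta> + x))\<^sup>2 * ?K (\<theta> + x))" for x
  let ?m\<^sub>1 = "1 - cos (jackson_angle d)"
  let ?m\<^sub>2 = "(1 - cos (jackson_angle d))\<^sup>2 + (sin (jackson_angle d))\<^sup>2 / (real d + 2)"
  have R: "(R has_integral (c\<^sub>1 * (pi * ?m\<^sub>1) + c\<^sub>2 * (pi * ?m\<^sub>2))) {0..pi}"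
    unfolding R_def[abs_def] using assms(6)
    by (intro has_integral_add has_integral_mult_right has_integral_folded_kernel_moment1
        has_integral_folded_kernel_moment2) auto
  \<comment> \<open>Three integrals combine: \<open>G\<close> yields q_d, the constant
    \<open>P \<theta>\<close> meets the kernel mass pi, and \<open>L\<close> contributes 0.\<close>
  have D: "(D has_integral (pi * (q_fun d p a b \<theta> - P \<theta>))) {0..pi}"
  proof -
    have "((\<lambda>x. if x \<in> {\<beta>..\<alpha>} then P x * (?K (\<theta> - x) + ?K (\<theta> + x)) else 0)
        has_integral (pi * q_fun d p a b \<theta>)) {0..pi}"
      using q_fun_eq_kernel_integral[OF ab] range assms(7,8)
      by (subst has_integral_restrict) (auto simp: P_def)
    then have 1: "((\<lambda>x. G x * (?K (\<theta> - x) + ?K (\<theta> + x))) has_integral (pi * q_fun d p a b \<theta>)) {0..pi}"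
      by (rule has_integral_spike_finite[rotated 2, where S = "{\<beta>, \<alpha>}"]) (auto simp: G_def)
    have 2: "((\<lambda>x. P \<theta> * (?K (\<theta> - x) + ?K (\<theta> + x))) has_integral (P \<theta> * pi)) {0..pi}"
      using has_integral_folded_jackson_kernel[of 0 d \<theta>]
      by (intro has_integral_mult_right) simp
    have K_commute: "?K (\<theta> - x) = ?K (x - \<theta>)" for x
      using jackson_kernel_minus[of d "x - \<theta>"] by simp
    have "((\<lambda>x. poly_cos_deriv p 1 \<theta> * (x - \<theta>) * ?K (x - \<theta>)) has_integral 0) {\<theta> - r..\<theta> + r}"
      by (rule has_integral_odd_about[where u = "\<lambda>x. poly_cos_deriv p 1 \<theta> * x * ?K x"])
         (auto simp: jackson_kernel_minus intro!: continuous_intros)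
    then have "((\<lambda>x. if x \<in> {\<theta> - r..\<theta> + r} then poly_cos_deriv p 1 \<theta> * (x - \<theta>) * ?K (x - \<theta>) else 0)
        has_integral 0) {0..pi}"
      using range r by (subst has_integral_restrict) auto
    then have "((\<lambda>x. L x * ?K (\<theta> - x)) has_integral 0) {0..pi}"
      by (rule has_integral_eq[rotated])
         (auto simp: L_def abs_le_iff K_commute)
    from has_integral_diff[OF has_integral_diff[OF 1 2] this] show ?thesis
      by (simp add: D_def[abs_def] algebra_simps)
  qed
  have DR: "\<bar>D x\<bar> \<le> R x" if "x \<in> {0..pi} - {0, pi, \<beta>, \<alpha>}" for x
  proof -
    have x: "0 < x" "x < pi" "x \<noteq> \<beta>" "x \<noteq> \<alpha>" using that by auto
    have "\<bar>D x\<bar> \<le> \<bar>G x - P \<theta> - L x\<bar> * ?K (\<theta> - x) + \<bar>G x - P \<theta>\<bar> * ?K (\<theta> + x)"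
      unfolding D_def using jackson_kernel_nonneg[of d]
      by (intro order_trans[OF abs_triangle_ineq]) (simp add: abs_mult)
    also have "\<dots> \<le> (c\<^sub>1 * (1 - cos (\<theta> - x)) + c\<^sub>2 * (1 - cos (\<theta> - x))\<^sup>2) * ?K (\<theta> - x)
        + (c\<^sub>1 * (1 - cos (\<theta> + x)) + c\<^sub>2 * (1 - cos (\<theta> + x))\<^sup>2) * ?K (\<theta> + x)"
      using minus[OF x] plus[OF x(1,2)] jackson_kernel_nonneg[of d]
      by (intro add_mono mult_right_mono)
    also have "\<dots> = R x" by (simp add: R_def algebra_simps)
    finally show ?thesis .
  qed
  \<comment> \<open>Integral comparison asks for the inequality at every point of [0, pi], so both
    functions are reset to 0 at the four points left out of the estimate.\<close>
  let ?T = "{0, pi, \<beta>, \<alpha>}"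
  have D': "((\<lambda>x. if x \<in> ?T then 0 else D x) has_integral (pi * (q_fun d p a b \<theta> - P \<theta>))) {0..pi}"
    by (rule has_integral_spike_finite[where S = ?T, OF _ _ D]) auto
  have R': "((\<lambda>x. if x \<in> ?T then 0 else R x) has_integral (c\<^sub>1 * (pi * ?m\<^sub>1) + c\<^sub>2 * (pi * ?m\<^sub>2))) {0..pi}"
    by (rule has_integral_spike_finite[where S = ?T, OF _ _ R]) auto
  have DR': "\<bar>if x \<in> ?T then 0 else D x\<bar> \<le> (if x \<in> ?T then 0 else R x)" if "x \<in> {0..pi}" for x
    using DR[of x] that by (cases "x \<in> ?T") (simp_all only: if_True if_False Diff_iff abs_zero simp_thms)
  have "pi * (q_fun d p a b \<theta> - P \<theta>) \<le> c\<^sub>1 * (pi * ?m\<^sub>1) + c\<^sub>2 * (pi * ?m\<^sub>2)"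
    by (rule has_integral_le[OF D' R']) (use DR' abs_le_iff in blast)
  moreover have "- (pi * (q_fun d p a b \<theta> - P \<theta>)) \<le> c\<^sub>1 * (pi * ?m\<^sub>1) + c\<^sub>2 * (pi * ?m\<^sub>2)"
    by (rule has_integral_le[OF has_integral_neg[OF D'] R']) (use DR' abs_le_iff in blast)
  ultimately have "\<bar>pi * (q_fun d p a b \<theta> - P \<theta>)\<bar> \<le> pi * (c\<^sub>1 * ?m\<^sub>1 + c\<^sub>2 * ?m\<^sub>2)"
    by (simp only: abs_le_iff) (simp add: algebra_simps)
  then have "\<bar>q_fun d p a b \<theta> - P \<theta>\<bar> \<le> c\<^sub>1 * ?m\<^sub>1 + c\<^sub>2 * ?m\<^sub>2"
    by (simp add: abs_mult)
  also have "\<dots> \<le> c\<^sub>1 * (pi\<^sup>2 / (2 * N\<^sup>2)) + c\<^sub>2 * (2 * pi\<^sup>2 / N ^ 3)"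
    using one_minus_cos_jackson_angle_le jackson_kernel_moment2_le[OF assms(6)] c
    unfolding N_def by (intro add_mono mult_left_mono) auto
  also have "\<dots> = pi ^ 6 * A / (r ^ 4 * N ^ 3) + pi ^ 4 * B / (8 * N\<^sup>2)"
  proof -
    have "c\<^sub>1 * (pi\<^sup>2 / (2 * N\<^sup>2)) = pi\<^sup>2 * pi\<^sup>2 * B / (8 * N\<^sup>2)"
      by (simp add: c\<^sub>1_def)
    moreover have "c\<^sub>2 * (2 * pi\<^sup>2 / N ^ 3) = pi ^ 4 * pi\<^sup>2 * A / (r ^ 4 * N ^ 3)"
      by (simp add: c\<^sub>2_def)
    moreover have "pi\<^sup>2 * pi\<^sup>2 = pi ^ 4" "pi ^ 4 * pi\<^sup>2 = pi ^ 6"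
      by (simp_all add: eval_nat_numeral)
    ultimately show ?thesis by (simp only: add.commute)
  qed
  finally show ?thesis
    using g[OF range(3,4)] by (simp add: A_def B_def r_def N_def)
qed

end
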